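(* Let an instance of the one-station bike repositioning problem be given by $m\ge1$, $C\ge1$, $s^{(0)}\in\{0,\dots,C\}$, net flows $d^{(1)},\dots,d^{(m)}\in\mathbb Z$, visiting epochs $1=e_1<\dots<e_w\le m$ ($w\ge1$), and integers $0\le q_i\le Q_i$ ($i=1,\dots,w$). The algorithm Global-Backward (described in the context) computes, in $O(m)$ time (arithmetic operations and comparisons), an optimal vector of interventions $\boldsymbol x^*$, i.e. an integer vector with $x_i^*\in[q_i-Q_i,q_i]$ for all $i$ that minimizes the total loss $L(\boldsymbol x)$ among all integer vectors $\boldsymbol x$ with $x_i\in[q_i-Q_i,q_i]$ for all $i$. Moreover, the vector returned by the algorithm induces at the final epoch $m$ the same stock as the null vector $\boldsymbol 0$, i.e. $s^{(m)}(\boldsymbol x^* )=s^{(m)}(\boldsymbol 0)$.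
   Context: Dynamics. Given $\boldsymbol x=[x_1,\dots,x_w]$, define for $h=1,\dots,m$, with $s^{(0)}(\boldsymbol x)=s^{(0)}$: $\hat s^{(h)}(\boldsymbol x)=s^{(h-1)}(\boldsymbol x)+d^{(h)}+x_i$ if $h=e_i$ for some $i$, and $\hat s^{(h)}(\boldsymbol x)=s^{(h-1)}(\boldsymbol x)+d^{(h)}$ otherwise; $l^{(h)+}(\boldsymbol x)=\max(0,\hat s^{(h)}(\boldsymbol x)-C)$ (surplus loss); $l^{(h)-}(\boldsymbol x)=\max(0,-\hat s^{(h)}(\boldsymbol x))$ (stockout loss); $s^{(h)}(\boldsymbol x)=\hat s^{(h)}(\boldsymbol x)-l^{(h)+}(\boldsymbol x)+l^{(h)-}(\boldsymbol x)$ (stock). Total loss: $L(\boldsymbol x)=\sum_{h=1}^m(l^{(h)+}(\boldsymbol x)+l^{(h)-}(\boldsymbol x))$. Subroutine Vehicle-Intervention$(\underline e,\overline e,q,Q)$, reading current arrays $s^{(h)},l^{(h)+},l^{(h)-}$: set $x^\infty=-l^{(\underline e)+}+l^{(\underline e)-}$, $L^\infty=0$, $\alpha=\beta=s^{(\underline e)}$. For $h=\underline e+1,\dots,\overline e$: set $\delta^+=\min(l^{(h)+},\alpha)$, $\delta^-=\min(l^{(h)-},C-\beta)$, then $x^\infty\leftarrow x^\infty-\delta^++\delta^-$, $L^\infty\leftarrow L^\infty+(l^{(h)+}-\delta^+)+(l^{(h)-}-\delta^-)$, $\alpha\leftarrow\min(\alpha-\delta^+,s^{(h)})$, $\beta\leftarrow\max(\beta+\delta^-,s^{(h)})$.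 At the end, if $x^\infty<q-Q$ set $x^Q=q-Q$, $L^Q=L^\infty+x^Q-x^\infty$; else if $x^\infty>q$ set $x^Q=q$, $L^Q=L^\infty+x^\infty-x^Q$; else $x^Q=x^\infty$, $L^Q=L^\infty$. Return $(x^Q,L^Q,x^\infty,L^\infty)$. Recursive procedure Rec$(i,\delta)$: if $i=0$, return the empty vector and the value $|\delta|$. If $i>0$, put $\underline e=e_i$, $\overline e=e_{i+1}$ and replace the net flow at epoch $\overline e$ by the fictitious value $d^{(\overline e)}=-s^{(\overline e-1)}-|\delta|$ if $\delta>0$, $d^{(\overline e)}=C-s^{(\overline e-1)}+|\delta|$ if $\delta<0$, $d^{(\overline e)}=0$ if $\delta=0$, and recompute the array entries at epoch $\overline e$ accordingly under the null intervention (so $s^{(\overline e)}=0,\ l^{(\overline e)-}=|\delta|,\ l^{(\overline e)+}=0$ if $\delta>0$; $s^{(\overline e)}=C,\ l^{(\overline e)+}=|\delta|,\ l^{(\overline e)-}=0$ if $\delta<0$; $s^{(\overline e)}=s^{(\overline e-1)}$ and zero losses if $\delta=0$). Call Vehicle-Intervention$(\underline e,\overline e,q_i,Q_i)$ to obtain $(x^Q,L^Q,x^\infty,L^\infty)$, call Rec$(i-1,x^\infty-x^Q)$ to obtain $(\boldsymbol x,L)$, and return the vector $[\boldsymbol x,x^Q]$ and the value $L+L^\infty$. Algorithm Global-Backward: compute the arrays $s^{(h)}=s^{(h)}(\boldsymbol 0)$, $l^{(h)\pm}=l^{(h)\pm}(\boldsymbol 0)$ for $h=1,\dots,m$. Call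 Vehicle-Intervention$(e_w,m,q_w,Q_w)$ to obtain $(x^Q,L^Q,x^\infty,L^\infty)$. Call Rec$(w-1,x^\infty-x^Q)$ to obtain $(\boldsymbol x,L)$. Return $\boldsymbol x^*=[\boldsymbol x,x^Q]$ and $L^*=L+L^\infty$. *)

theory Defs
  imports Main "HOL-Library.Monad_Syntax"
begin

section \<open>Instances\<close>

text \<open>
  All families indexed by epochs or visits are functions on \<^typ>\<open>nat\<close>; only
  the values at \<open>d 1, \<dots>, d m\<close> and \<open>e 1, \<dots>, e w\<close> (likewise for \<open>q\<close> and \<open>Q\<close>) are
  relevant.  The field \<open>init\<close> is the stock before epoch \<open>1\<close>; \<open>load\<close> is \<open>q\<close> and \<open>vcap\<close>
  is \<open>Q\<close>, so that the interventions allowed at visit \<open>i\<close> are those in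
  \<open>[load i - vcap i, load i]\<close>.
\<close>

record instance_data =
  epochs :: nat
  capacity :: int
  init :: int
  flow :: "nat \<Rightarrow> int"
  visits :: nat
  visit :: "nat \<Rightarrow> nat"
  load :: "nat \<Rightarrow> int"
  vcap :: "nat \<Rightarrow> int"

definition valid_instance :: "instance_data \<Rightarrow> bool" where
  "valid_instance I \<longleftrightarrow>
     1 \<le> epochs I \<and> 1 \<le> capacity I \<and> 0 \<le> init I \<and> init I \<le> capacity I \<and>
     1 \<le> visits I \<and> visit I 1 = 1 \<and> strict_mono_on {1..visits I} (visit I) \<and>
     visit I (visits I) \<le> epochs I \<and>
     (\<forall>i\<in>{1..visits I}. 0 \<le> load I i \<and> load I i \<le> vcap I i)"


section \<open>Dynamics and total loss\<close>

text \<open>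
  An intervention vector is a list; its component \<open>x\<^sub>i\<close>, counted from \<open>1\<close>, is
  \<open>xs ! (i - 1)\<close>.
\<close>

definition intervention :: "instance_data \<Rightarrow> int list \<Rightarrow> nat \<Rightarrow> int" where
  "intervention I xs h =
     (if \<exists>i\<in>{1..visits I}. h = visit I i
      then xs ! ((THE i. i \<in> {1..visits I} \<and> h = visit I i) - 1)
      else 0)"

definition surplus_of :: "int \<Rightarrow> int \<Rightarrow> int" where
  "surplus_of C r = max 0 (r - C)"

definition stockout_of :: "int \<Rightarrow> int" where
  "stockout_of r = max 0 (- r)"

fun stock :: "instance_data \<Rightarrow> int list \<Rightarrow> nat \<Rightarrow> int" where
  "stock I xs 0 = init I"
| "stock I xs (Suc h) =
     (let r = stock I xs h + flow I (Suc h) + intervention I xs (Suc h)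
      in r - surplus_of (capacity I) r + stockout_of r)"

definition raw_stock :: "instance_data \<Rightarrow> int list \<Rightarrow> nat \<Rightarrow> int" where
  "raw_stock I xs h = stock I xs (h - 1) + flow I h + intervention I xs h"

definition surplus_loss :: "instance_data \<Rightarrow> int list \<Rightarrow> nat \<Rightarrow> int" where
  "surplus_loss I xs h = surplus_of (capacity I) (raw_stock I xs h)"

definition stockout_loss :: "instance_data \<Rightarrow> int list \<Rightarrow> nat \<Rightarrow> int" where
  "stockout_loss I xs h = stockout_of (raw_stock I xs h)"

lemma stock_eq:
  assumes "1 \<le> h"
  shows "stock I xs h = raw_stock I xs h - surplus_loss I xs h + stockout_loss I xs h"
  using assms by (cases h) (auto simp: raw_stock_def surplus_loss_def stockout_loss_def Let_def)

definition total_loss :: "instance_data \<Rightarrow> int list \<Rightarrow> int" where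
  "total_loss I xs = (\<Sum>h=1..epochs I. surplus_loss I xs h + stockout_loss I xs h)"

definition null_vector :: "instance_data \<Rightarrow> int list" where
  "null_vector I = replicate (visits I) 0"

definition feasible :: "instance_data \<Rightarrow> int list \<Rightarrow> bool" where
  "feasible I xs \<longleftrightarrow> length xs = visits I \<and>
     (\<forall>i\<in>{1..visits I}. xs ! (i - 1) \<in> {load I i - vcap I i .. load I i})"

definition optimal :: "instance_data \<Rightarrow> int list \<Rightarrow> bool" where
  "optimal I xs \<longleftrightarrow> feasible I xs \<and>
     (\<forall>ys. feasible I ys \<longrightarrow> total_loss I xs \<le> total_loss I ys)"


section \<open>Programs with operation counting\<close>

text \<open>
  \<open>Timed v n\<close> is a computation with result \<open>v\<close> that used \<open>n\<close> elementary
  operations.  The programs below wrap in \<open>step\<close> every application of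
  \<open>+\<close>, \<open>-\<close> (also unary), \<open>min\<close>, \<open>max\<close>, absolute value, \<open><\<close>, \<open>\<le>\<close> or \<open>=\<close>, exactly one per
  \<open>step\<close>, including those on loop counters and array indices; reading and writing
  variables, array entries and the input is free, and so is the extension \<open>xs @ [x]\<close> of an
  output vector, which stands for writing its next entry.
\<close>

datatype 'a timed = Timed (result: 'a) (ops: nat)

definition return :: "'a \<Rightarrow> 'a timed" where
  "return v = Timed v 0"

definition step :: "'a \<Rightarrow> 'a timed" where
  "step v = Timed v 1"

definition bind_timed :: "'a timed \<Rightarrow> ('a \<Rightarrow> 'b timed) \<Rightarrow> 'b timed" where
  "bind_timed c f = Timed (result (f (result c))) (ops c + ops (f (result c)))"

adhoc_overloading Monad_Syntax.bind == bind_timed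

text \<open>
  \<open>for_loop body l u a\<close> runs \<open>body h\<close> for \<open>h = l, \<dots>, u\<close> on the loop state \<open>a\<close>.
  Since a function definition cannot see through \<open>step\<close> that the counter increases, the
  test \<open>l \<le> u\<close> and the increment are charged by \<open>step ()\<close>.
\<close>

function for_loop :: "(nat \<Rightarrow> 'a \<Rightarrow> 'a timed) \<Rightarrow> nat \<Rightarrow> nat \<Rightarrow> 'a \<Rightarrow> 'a timed" where
  "for_loop body l u a = do {
     step ();
     if l \<le> u then do {
       a' \<leftarrow> body l a;
       step ();
       for_loop body (l + 1) u a'
     } else return a
   }"
  by pat_completeness auto
termination
  by (relation "measure (\<lambda>(_, l, u, _). u + 1 - l)") auto

declare for_loop.simps [simp del]


section \<open>Global-Backward\<close>

record arrays =
  arr_d :: "nat \<Rightarrow> int"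
  arr_s :: "nat \<Rightarrow> int"
  arr_sur :: "nat \<Rightarrow> int"
  arr_out :: "nat \<Rightarrow> int"

text \<open>(Re)computation of the array entries at epoch \<open>h\<close> under the null intervention.\<close>

definition update_epoch :: "int \<Rightarrow> nat \<Rightarrow> arrays \<Rightarrow> arrays timed" where
  "update_epoch C h A = do {
     k \<leftarrow> step (h - 1);
     r \<leftarrow> step (arr_s A k + arr_d A h);
     t \<leftarrow> step (r - C);
     lp \<leftarrow> step (max 0 t);
     t \<leftarrow> step (- r);
     lm \<leftarrow> step (max 0 t);
     t \<leftarrow> step (r - lp);
     s \<leftarrow> step (t + lm);
     return (A\<lparr>arr_s := (arr_s A)(h := s),
               arr_sur := (arr_sur A)(h := lp),
               arr_out := (arr_out A)(h := lm)\<rparr>)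
   }"

text \<open>The entries of the losses outside \<open>1, \<dots>, m\<close> are arbitrary and never read.\<close>

definition null_arrays :: "instance_data \<Rightarrow> arrays timed" where
  "null_arrays I =
     for_loop (update_epoch (capacity I)) 1 (epochs I)
       \<lparr>arr_d = flow I, arr_s = (\<lambda>_. init I), arr_sur = (\<lambda>_. 0), arr_out = (\<lambda>_. 0)\<rparr>"

text \<open>The loop state is \<open>(x\<^sup>\<infinity>, L\<^sup>\<infinity>, \<alpha>, \<beta>)\<close>.\<close>

definition vi_body ::
  "int \<Rightarrow> arrays \<Rightarrow> nat \<Rightarrow> int \<times> int \<times> int \<times> int \<Rightarrow> (int \<times> int \<times> int \<times> int) timed" where
  "vi_body C A h = (\<lambda>(xinf, Linf, \<alpha>, \<beta>). do {
     \<delta>p \<leftarrow> step (min (arr_sur A h) \<alpha>);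
     t \<leftarrow> step (C - \<beta>);
     \<delta>m \<leftarrow> step (min (arr_out A h) t);
     t \<leftarrow> step (xinf - \<delta>p);
     xinf' \<leftarrow> step (t + \<delta>m);
     t1 \<leftarrow> step (arr_sur A h - \<delta>p);
     t2 \<leftarrow> step (arr_out A h - \<delta>m);
     t \<leftarrow> step (Linf + t1);
     Linf' \<leftarrow> step (t + t2);
     t \<leftarrow> step (\<alpha> - \<delta>p);
     \<alpha>' \<leftarrow> step (min t (arr_s A h));
     t \<leftarrow> step (\<beta> + \<delta>m);
     \<beta>' \<leftarrow> step (max t (arr_s A h));
     return (xinf', Linf', \<alpha>', \<beta>')
   })"

text \<open>The result is \<open>(x\<^sup>Q, L\<^sup>Q, x\<^sup>\<infinity>, L\<^sup>\<infinity>)\<close>.\<close>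

definition vehicle_intervention ::
  "int \<Rightarrow> arrays \<Rightarrow> nat \<Rightarrow> nat \<Rightarrow> int \<Rightarrow> int \<Rightarrow> (int \<times> int \<times> int \<times> int) timed" where
  "vehicle_intervention C A eu eo q Q = do {
     t \<leftarrow> step (- arr_sur A eu);
     x0 \<leftarrow> step (t + arr_out A eu);
     h0 \<leftarrow> step (eu + 1);
     (xinf, Linf, _, _) \<leftarrow> for_loop (vi_body C A) h0 eo (x0, 0, arr_s A eu, arr_s A eu);
     lo \<leftarrow> step (q - Q);
     below \<leftarrow> step (xinf < lo);
     if below then do {
       t \<leftarrow> step (Linf + lo);
       LQ \<leftarrow> step (t - xinf);
       return (lo, LQ, xinf, Linf)
     } else do {
       above \<leftarrow> step (q < xinf);
       if above then do {
         t \<leftarrow> step (Linf + xinf);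
         LQ \<leftarrow> step (t - q);
         return (q, LQ, xinf, Linf)
       } else return (xinf, Linf, xinf, Linf)
     }
   }"

text \<open>
  The fictitious net flow at epoch \<open>eo\<close> that carries the residual \<open>\<delta>\<close> back to the
  preceding visit.
\<close>

definition fictitious_flow :: "int \<Rightarrow> arrays \<Rightarrow> nat \<Rightarrow> int \<Rightarrow> int timed" where
  "fictitious_flow C A eo \<delta> = do {
     k \<leftarrow> step (eo - 1);
     a \<leftarrow> step \<bar>\<delta>\<bar>;
     pos \<leftarrow> step (0 < \<delta>);
     if pos then do {
       t \<leftarrow> step (- arr_s A k);
       step (t - a)
     } else do {
       neg \<leftarrow> step (\<delta> < 0);
       if neg then do {
         t \<leftarrow> step (C - arr_s A k);
         step (t + a)
       } else return 0
     }
   }"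

text \<open>
  The two occurrences of \<open>step ()\<close> charge the test \<open>i = 0\<close> and the decrement of \<open>i\<close>, which
  are performed by pattern matching.
\<close>

fun backward_rec :: "instance_data \<Rightarrow> nat \<Rightarrow> arrays \<Rightarrow> int \<Rightarrow> (int list \<times> int) timed" where
  "backward_rec I 0 A \<delta> = do {
     step ();
     a \<leftarrow> step \<bar>\<delta>\<bar>;
     return ([], a)
   }"
| "backward_rec I (Suc j) A \<delta> = do {
     step ();
     let i = Suc j;
     i' \<leftarrow> step (i + 1);
     let eu = visit I i;
     let eo = visit I i';
     f \<leftarrow> fictitious_flow (capacity I) A eo \<delta>;
     A' \<leftarrow> update_epoch (capacity I) eo (A\<lparr>arr_d := (arr_d A)(eo := f)\<rparr>);
     (xQ, LQ, xinf, Linf) \<leftarrow>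
       vehicle_intervention (capacity I) A' eu eo (load I i) (vcap I i);
     \<delta>' \<leftarrow> step (xinf - xQ);
     step ();
     (xs, L) \<leftarrow> backward_rec I j A' \<delta>';
     L' \<leftarrow> step (L + Linf);
     return (xs @ [xQ], L')
   }"

definition global_backward :: "instance_data \<Rightarrow> (int list \<times> int) timed" where
  "global_backward I = do {
     let w = visits I;
     A \<leftarrow> null_arrays I;
     (xQ, LQ, xinf, Linf) \<leftarrow>
       vehicle_intervention (capacity I) A (visit I w) (epochs I) (load I w) (vcap I w);
     \<delta> \<leftarrow> step (xinf - xQ);
     j \<leftarrow> step (w - 1);
     (xs, L) \<leftarrow> backward_rec I j A \<delta>;
     L' \<leftarrow> step (L + Linf);
     return (xs @ [xQ], L')
   }"

end

theory Submission
  imports Defs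
begin

text \<open>
  Let \<open>s\<close> be the stock under the null vector.  Running the station backwards in time from
  \<open>p m = s m\<close>, with the intervention \<open>x h\<close> obtained by clamping \<open>p h - s (h - 1) - d h\<close> to the
  admissible interval, gives target stocks \<open>p (h - 1) = clamp 0 C (p h - d h - x h)\<close>.
  The minimal loss from epoch \<open>h + 1\<close> on, as a function of the stock \<open>t\<close> after epoch \<open>h\<close>, is
  a constant plus the distance of \<open>t\<close> to an interval, and \<open>p h\<close> is the point of this interval
  nearest to \<open>s h\<close>.  Hence it suffices to bound the loss below by the one-sided distance of \<open>t\<close>
  to \<open>p h\<close>, directed away from \<open>s h\<close>, and to observe that the stock induced by \<open>x\<close> always stays
  between \<open>s h\<close> and \<open>p h\<close>, where this bound is attained.  The forward scan of
  Vehicle-Intervention computes exactly the correction \<open>p h - s (h - 1) - d h\<close>, and the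
  fictitious flow starts the scan of the preceding segment from the right target.
\<close>

section \<open>Clamping\<close>

definition clamp :: "int \<Rightarrow> int \<Rightarrow> int \<Rightarrow> int" where
  "clamp a b v = max a (min b v)"

text \<open>The distance from \<open>t\<close> to the ray that starts at \<open>p\<close> and points
  away from \<open>s\<close>; for \<open>s = p\<close> it vanishes, and the bound on the remaining
  loss is then constant.\<close>

definition directed_gap :: "int \<Rightarrow> int \<Rightarrow> int \<Rightarrow> int" where
  "directed_gap s p t = (if s < p then max 0 (p - t) else if p < s then max 0 (t - p) else 0)"

lemma clamp_bounds: "a \<le> b \<Longrightarrow> a \<le> clamp a b v \<and> clamp a b v \<le> b"
  by (auto simp: clamp_def)

lemma clamp_losses:
  "0 \<le> C \<Longrightarrow> r - surplus_of C r + stockout_of r = clamp 0 C r"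
  by (auto simp: clamp_def surplus_of_def stockout_of_def)

lemma losses_clamp:
  "0 \<le> C \<Longrightarrow> surplus_of C r + stockout_of r = \<bar>r - clamp 0 C r\<bar>"
  by (auto simp: clamp_def surplus_of_def stockout_of_def)

text \<open>Bellman inequality for one epoch. If the clamp in \<open>x\<close> is inactive, then
  \<open>p' = s\<close> and the left side is 0. If \<open>x = hi\<close>, the left side is at most
  the shortage of \<open>t + d + hi\<close> below \<open>p\<close>; no admissible \<open>y\<close>
  removes it, so it reappears as loss or as gap of \<open>t'\<close>. The case \<open>x = lo\<close>
  is symmetric.\<close>

lemma directed_gap_step:
  assumes "lo \<le> 0" "0 \<le> hi" "lo \<le> y" "y \<le> hi"
    and "0 \<le> s" "s \<le> C" "0 \<le> t" "t \<le> C" "0 \<le> p" "p \<le> C"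
    and "x = clamp lo hi (p - (s + d))" "p' = clamp 0 C (p - d - x)"
    and "s' = clamp 0 C (s + d)" "t' = clamp 0 C (t + d + y)"
  shows "directed_gap s p' t + \<bar>p - d - x - p'\<bar> \<le> directed_gap s' p t' + \<bar>t + d + y - t'\<bar>"
  using assms unfolding directed_gap_def clamp_def by (smt (verit))

text \<open>The equality case. With the clamp inactive, \<open>t = s = p'\<close> is carried exactly
  to \<open>p\<close> without loss. With \<open>x = hi\<close>, both sides equal
  \<open>p - (t + d + hi)\<close>, because \<open>t\<close> does not exceed \<open>p'\<close> and so
  cannot overshoot \<open>p\<close>.\<close>

lemma between_step:
  assumes "lo \<le> 0" "0 \<le> hi"
    and "0 \<le> s" "s \<le> C" "0 \<le> p" "p \<le> C"
    and "x = clamp lo hi (p - (s + d))" "p' = clamp 0 C (p - d - x)"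
    and "s' = clamp 0 C (s + d)" "t' = clamp 0 C (t + d + x)"
    and "min s p' \<le> t" "t \<le> max s p'"
  shows "min s' p \<le> t' \<and> t' \<le> max s' p \<and>
    \<bar>p' - t\<bar> + \<bar>p - d - x - p'\<bar> = \<bar>p - t'\<bar> + \<bar>t + d + x - t'\<bar>"
  using assms unfolding clamp_def by (smt (verit))

section \<open>Interventions and target stocks\<close>

lemma visit_inj:
  assumes "valid_instance I"
  shows "inj_on (visit I) {1..visits I}"
  using assms by (auto simp: valid_instance_def intro: strict_mono_on_imp_inj_on)

lemma intervention_visit:
  assumes "valid_instance I" "i \<in> {1..visits I}"
  shows "intervention I xs (visit I i) = xs ! (i - 1)"
proof -
  have "(THE k. k \<in> {1..visits I} \<and> visit I i = visit I k) = i"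
    using visit_inj[OF assms(1)] assms(2) by (intro the_equality) (auto dest: inj_onD)
  then show ?thesis
    using assms(2) by (auto simp: intervention_def)
qed

lemma intervention_no_visit: "h \<notin> visit I ` {1..visits I} \<Longrightarrow> intervention I xs h = 0"
  by (auto simp: intervention_def)

lemma intervention_null:
  assumes "valid_instance I"
  shows "intervention I (null_vector I) h = 0"
proof (cases "h \<in> visit I ` {1..visits I}")
  case True
  then obtain i where "i \<in> {1..visits I}" "h = visit I i" by auto
  then show ?thesis
    using intervention_visit[OF assms, of i] by (auto simp: null_vector_def)
qed (simp add: intervention_no_visit)

section \<open>Admissible corrections and backward targets\<close>

abbreviation (input) null_stock :: "instance_data \<Rightarrow> nat \<Rightarrow> int" where
  "null_stock I \<equiv> stock I (null_vector I)"

text \<open>Reading the bounds through \<open>intervention\<close> makes them 0 outside the visits,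
  so that all epochs can be treated alike.\<close>

definition lower :: "instance_data \<Rightarrow> nat \<Rightarrow> int" where
  "lower I = intervention I (map (\<lambda>i. load I (Suc i) - vcap I (Suc i)) [0..<visits I])"

definition upper :: "instance_data \<Rightarrow> nat \<Rightarrow> int" where
  "upper I = intervention I (map (\<lambda>i. load I (Suc i)) [0..<visits I])"

definition correction :: "instance_data \<Rightarrow> nat \<Rightarrow> int \<Rightarrow> int" where
  "correction I h p = clamp (lower I h) (upper I h) (p - (null_stock I (h - 1) + flow I h))"

text \<open>The argument counts epochs back from the end, which makes the recursion primitive;
  \<open>target\<close> returns to epoch numbers.\<close>

fun back_stock :: "instance_data \<Rightarrow> nat \<Rightarrow> int" where
  "back_stock I 0 = null_stock I (epochs I)"
| "back_stock I (Suc k) =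
     (let h = epochs I - k
      in clamp 0 (capacity I) (back_stock I k - flow I h - correction I h (back_stock I k)))"

definition target :: "instance_data \<Rightarrow> nat \<Rightarrow> int" where
  "target I h = back_stock I (epochs I - h)"

definition policy :: "instance_data \<Rightarrow> nat \<Rightarrow> int" where
  "policy I h = correction I h (target I h)"

lemma lower_visit:
  assumes "valid_instance I" "i \<in> {1..visits I}"
  shows "lower I (visit I i) = load I i - vcap I i"
  unfolding lower_def intervention_visit[OF assms] using assms(2) by auto

lemma upper_visit:
  assumes "valid_instance I" "i \<in> {1..visits I}"
  shows "upper I (visit I i) = load I i"
  unfolding upper_def intervention_visit[OF assms] using assms(2) by auto

lemma bounds_signs:
  assumes "valid_instance I"
  shows "lower I h \<le> 0 \<and> 0 \<le> upper I h"
proof (cases "h \<in> visit I ` {1..visits I}")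
  case True
  then show ?thesis
    using assms by (auto simp: lower_visit upper_visit valid_instance_def)
qed (simp add: lower_def upper_def intervention_no_visit)

lemma feasible_bounds:
  assumes "valid_instance I" "feasible I xs"
  shows "lower I h \<le> intervention I xs h \<and> intervention I xs h \<le> upper I h"
proof (cases "h \<in> visit I ` {1..visits I}")
  case True
  then show ?thesis
    using assms by (auto simp: lower_visit upper_visit intervention_visit feasible_def)
qed (simp add: lower_def upper_def intervention_no_visit)

lemma policy_no_visit: "h \<notin> visit I ` {1..visits I} \<Longrightarrow> policy I h = 0"
  by (simp add: policy_def correction_def lower_def upper_def intervention_no_visit clamp_def)

lemma policy_visit:
  assumes "valid_instance I" "i \<in> {1..visits I}"
  shows "policy I (visit I i) = clamp (load I i - vcap I i) (load I i)
    (target I (visit I i) - (null_stock I (visit I i - 1) + flow I (visit I i)))"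
  by (simp add: policy_def correction_def lower_visit[OF assms] upper_visit[OF assms])

section \<open>Clamped dynamics in both time directions\<close>

lemma stock_Suc:
  assumes "valid_instance I"
  shows "stock I xs (Suc h) =
    clamp 0 (capacity I) (stock I xs h + flow I (Suc h) + intervention I xs (Suc h))"
  using assms by (simp add: Let_def clamp_losses valid_instance_def)

lemma stock_bounds:
  assumes "valid_instance I"
  shows "0 \<le> stock I xs h \<and> stock I xs h \<le> capacity I"
proof (cases h)
  case (Suc k)
  then show ?thesis
    using assms clamp_bounds[of 0 "capacity I"]
    by (simp add: stock_Suc valid_instance_def del: stock.simps)
qed (use assms in \<open>simp add: valid_instance_def\<close>)

lemma null_stock_Suc:
  assumes "valid_instance I"
  shows "null_stock I (Suc h) = clamp 0 (capacity I) (null_stock I h + flow I (Suc h))"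
  using assms by (simp add: stock_Suc intervention_null del: stock.simps)

lemma target_final: "target I (epochs I) = null_stock I (epochs I)"
  by (simp add: target_def)

lemma target_back:
  assumes "h < epochs I"
  shows "target I h =
    clamp 0 (capacity I) (target I (Suc h) - flow I (Suc h) - policy I (Suc h))"
proof -
  have "epochs I - h = Suc (epochs I - Suc h)" "epochs I - (epochs I - Suc h) = Suc h"
    using assms by auto
  then show ?thesis
    by (simp add: target_def policy_def Let_def)
qed

lemma target_bounds:
  assumes "valid_instance I"
  shows "0 \<le> target I h \<and> target I h \<le> capacity I"
proof (cases "epochs I - h")
  case 0
  then show ?thesis using stock_bounds[OF assms] by (simp add: target_def)
next
  case (Suc k)
  then show ?thesis
    using assms clamp_bounds[of 0 "capacity I"]
    by (simp add: target_def Let_def valid_instance_def)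
qed

section \<open>Optimality of the policy\<close>

text \<open>The amount cut off by the capacity bounds when the target is carried back over the
  epoch; it is the contribution of this epoch to the constant in the lower bound.\<close>

definition back_loss :: "instance_data \<Rightarrow> nat \<Rightarrow> int" where
  "back_loss I h = \<bar>target I h - flow I h - policy I h - target I (h - 1)\<bar>"

definition loss :: "instance_data \<Rightarrow> int list \<Rightarrow> nat \<Rightarrow> int" where
  "loss I xs h = surplus_loss I xs h + stockout_loss I xs h"

lemma loss_Suc:
  assumes "valid_instance I"
  shows "loss I xs (Suc h) =
    \<bar>stock I xs h + flow I (Suc h) + intervention I xs (Suc h) - stock I xs (Suc h)\<bar>"
  using assms unfolding stock_Suc[OF assms]
  by (simp add: loss_def surplus_loss_def stockout_loss_def raw_stock_def losses_clamp
      valid_instance_def del: stock.simps)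

text \<open>Telescopes \<open>directed_gap_step\<close> from epoch 0 on. At the final epoch the gap
  vanishes, which leaves a bound independent of \<open>xs\<close>.\<close>

lemma loss_lower_bound:
  assumes "valid_instance I" "feasible I xs" "h \<le> epochs I"
  shows "\<bar>target I 0 - init I\<bar> + (\<Sum>k=1..h. back_loss I k)
    \<le> (\<Sum>k=1..h. loss I xs k) + directed_gap (null_stock I h) (target I h) (stock I xs h)"
  using assms(3)
proof (induction h)
  case 0
  \<comment> \<open>Both stocks start at \<open>init I\<close>, so the one-sided gap is the full
    distance to the target.\<close>
  then show ?case by (auto simp: directed_gap_def)
next
  case (Suc h)
  have "directed_gap (null_stock I h) (target I h) (stock I xs h)
      + \<bar>target I (Suc h) - flow I (Suc h) - policy I (Suc h) - target I h\<bar>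
    \<le> directed_gap (null_stock I (Suc h)) (target I (Suc h)) (stock I xs (Suc h))
      + \<bar>stock I xs h + flow I (Suc h) + intervention I xs (Suc h) - stock I xs (Suc h)\<bar>"
    using Suc.prems assms(1,2)
    by (intro directed_gap_step[where lo = "lower I (Suc h)" and hi = "upper I (Suc h)"
          and C = "capacity I"])
      (simp_all add: bounds_signs feasible_bounds stock_bounds target_bounds target_back
        intervention_null stock_Suc policy_def correction_def del: stock.simps)
  then have "directed_gap (null_stock I h) (target I h) (stock I xs h) + back_loss I (Suc h)
    \<le> directed_gap (null_stock I (Suc h)) (target I (Suc h)) (stock I xs (Suc h))
      + loss I xs (Suc h)"
    by (simp add: back_loss_def loss_Suc[OF assms(1)] del: stock.simps)
  with Suc show ?case by (simp del: stock.simps)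
qed

text \<open>The sandwich is carried through the same induction because \<open>between_step\<close>
  needs it to turn the inequality into an equality.\<close>

lemma policy_loss:
  assumes "valid_instance I" "\<And>h. intervention I xs h = policy I h" "h \<le> epochs I"
  shows "min (null_stock I h) (target I h) \<le> stock I xs h \<and>
    stock I xs h \<le> max (null_stock I h) (target I h) \<and>
    \<bar>target I 0 - init I\<bar> + (\<Sum>k=1..h. back_loss I k)
    = (\<Sum>k=1..h. loss I xs k) + \<bar>target I h - stock I xs h\<bar>"
  using assms(3)
proof (induction h)
  case 0
  then show ?case by auto
next
  case (Suc h)
  then have IH: "min (null_stock I h) (target I h) \<le> stock I xs h"
    "stock I xs h \<le> max (null_stock I h) (target I h)"
    by auto
  have "min (null_stock I (Suc h)) (target I (Suc h)) \<le> stock I xs (Suc h) \<and>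
    stock I xs (Suc h) \<le> max (null_stock I (Suc h)) (target I (Suc h)) \<and>
    \<bar>target I h - stock I xs h\<bar>
      + \<bar>target I (Suc h) - flow I (Suc h) - policy I (Suc h) - target I h\<bar>
    = \<bar>target I (Suc h) - stock I xs (Suc h)\<bar>
      + \<bar>stock I xs h + flow I (Suc h) + policy I (Suc h) - stock I xs (Suc h)\<bar>"
    by (rule between_step[where s = "null_stock I h" and C = "capacity I"
          and lo = "lower I (Suc h)" and hi = "upper I (Suc h)"])
      (use Suc.prems IH assms(1,2) in \<open>simp_all add: bounds_signs stock_bounds
        target_bounds target_back[of h] intervention_null stock_Suc policy_def correction_def
        del: stock.simps\<close>)
  with Suc show ?case
    by (simp add: back_loss_def loss_Suc[OF assms(1)] assms(2) del: stock.simps)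
qed

lemma policy_optimal:
  assumes valid: "valid_instance I" and len: "length xs = visits I"
    and xs: "\<And>i. i \<in> {1..visits I} \<Longrightarrow> xs ! (i - 1) = policy I (visit I i)"
  shows "optimal I xs \<and> stock I xs (epochs I) = null_stock I (epochs I)"
proof -
  have int: "intervention I xs h = policy I h" for h
    using intervention_visit[OF valid] xs
    by (cases "h \<in> visit I ` {1..visits I}") (auto simp: intervention_no_visit policy_no_visit)
  \<comment> \<open>At the last epoch the target is the null stock: the sandwich fixes the final
    stock, and the remaining distance is 0.\<close>
  note loss = policy_loss[OF valid int order_refl, unfolded target_final]
  have "feasible I xs"
    unfolding feasible_def
  proof (intro conjI ballI)
    fix i assume i: "i \<in> {1..visits I}"
    then have "0 \<le> load I i \<and> load I i \<le> vcap I i"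
      using valid by (simp add: valid_instance_def)
    then show "xs ! (i - 1) \<in> {load I i - vcap I i..load I i}"
      unfolding xs[OF i] policy_visit[OF valid i] atLeastAtMost_iff
      by (intro clamp_bounds) simp
  qed (rule len)
  moreover have "total_loss I xs \<le> total_loss I ys" if "feasible I ys" for ys
  proof -
    have "total_loss I zs = (\<Sum>k=1..epochs I. loss I zs k)" for zs
      by (simp add: total_loss_def loss_def)
    then show ?thesis
      using loss loss_lower_bound[OF valid that order_refl]
      by (simp add: target_final directed_gap_def)
  qed
  ultimately show ?thesis
    using loss by (simp add: optimal_def)
qed

section \<open>Results of the programs\<close>

lemma result_simps [simp]:
  "result (return v) = v" "result (step v) = v"
  "result (bind_timed c f) = result (f (result c))"
  by (simp_all add: return_def step_def bind_timed_def)

lemma ops_simps [simp]: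
  "ops (return v) = 0" "ops (step v) = 1"
  "ops (bind_timed c f) = ops c + ops (f (result c))"
  by (simp_all add: return_def step_def bind_timed_def)

text \<open>\<open>P h\<close> describes the state before iteration \<open>h\<close>;
  \<open>l \<le> Suc u\<close> admits the empty loop and fixes the exit index.\<close>

lemma for_loop_invariant:
  assumes "P l a" "l \<le> Suc u"
    and "\<And>h b. l \<le> h \<Longrightarrow> h \<le> u \<Longrightarrow> P h b \<Longrightarrow> P (Suc h) (result (body h b))"
  shows "P (Suc u) (result (for_loop body l u a))"
  using assms
proof (induction "Suc u - l" arbitrary: l a)
  case 0
  then show ?case by (simp add: for_loop.simps[of _ l] le_antisym)
next
  case (Suc n)
  then have "l \<le> u" by simp
  moreover have "P (Suc u) (result (for_loop body (Suc l) u (result (body l a))))"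
    by (rule Suc.hyps) (use Suc.hyps(2) Suc.prems \<open>l \<le> u\<close> in auto)
  ultimately show ?case by (simp add: for_loop.simps[of _ l])
qed

text \<open>Each iteration adds a test and an increment to its body; the leading 1 is the failing
  test.\<close>

lemma for_loop_ops:
  assumes "\<And>h b. ops (body h b) \<le> k"
  shows "ops (for_loop body l u a) \<le> 1 + (k + 2) * (Suc u - l)"
proof (induction "Suc u - l" arbitrary: l a)
  case 0
  then show ?case by (simp add: for_loop.simps[of _ l])
next
  case (Suc n)
  then have "l \<le> u" "Suc u - l = Suc n" "Suc u - Suc l = n" by auto
  then show ?case
    using Suc.hyps(1)[of "Suc l" "result (body l a)"] assms[of l a]
    by (simp add: for_loop.simps[of _ l])
qed

text \<open>Stated for the flow stored in the arrays, so that it also applies at an epoch with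
  fictitious flow.\<close>

definition consistent_at :: "int \<Rightarrow> arrays \<Rightarrow> nat \<Rightarrow> bool" where
  "consistent_at C A h \<longleftrightarrow>
     (let r = arr_s A (h - 1) + arr_d A h
      in arr_sur A h = surplus_of C r \<and> arr_out A h = stockout_of r \<and>
         arr_s A h = r - arr_sur A h + arr_out A h)"

lemma result_update_epoch:
  assumes "1 \<le> h"
  shows "consistent_at C (result (update_epoch C h A)) h"
    and "arr_d (result (update_epoch C h A)) = arr_d A"
    and "k \<noteq> h \<Longrightarrow> arr_s (result (update_epoch C h A)) k = arr_s A k"
  using assms
  by (auto simp: update_epoch_def consistent_at_def surplus_of_def stockout_of_def Let_def)

text \<open>Consistency at \<open>Suc h\<close> reads the overwritten stock at \<open>h\<close>,
  hence the restriction to earlier epochs.\<close>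

lemma consistent_at_update_other:
  assumes "1 \<le> k" "k < h"
  shows "consistent_at C (result (update_epoch C h A)) k \<longleftrightarrow> consistent_at C A k"
  using assms by (auto simp: update_epoch_def consistent_at_def Let_def)

text \<open>Entries from \<open>n\<close> on are left free, since the recursion overwrites them with
  fictitious data from right to left.\<close>

definition null_before :: "instance_data \<Rightarrow> arrays \<Rightarrow> nat \<Rightarrow> bool" where
  "null_before I A n \<longleftrightarrow>
     (\<forall>h<n. arr_s A h = null_stock I h \<and>
       (1 \<le> h \<longrightarrow> arr_d A h = flow I h \<and> consistent_at (capacity I) A h))"

lemma null_arrays_null:
  assumes "valid_instance I"
  shows "null_before I (result (null_arrays I)) (Suc (epochs I))"
proof -
  \<comment> \<open>The flows of epochs still to be processed are not covered by
    \<open>null_before\<close>, so the invariant carries them separately.\<close>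
  have "(arr_d A = flow I \<and> null_before I A h)
      \<Longrightarrow> arr_d (result (update_epoch (capacity I) h A)) = flow I \<and>
        null_before I (result (update_epoch (capacity I) h A)) (Suc h)" if h: "1 \<le> h" for h A
  proof -
    let ?B = "result (update_epoch (capacity I) h A)"
    assume A: "arr_d A = flow I \<and> null_before I A h"
    obtain k where k: "h = Suc k" using h by (cases h) auto
    note upd = result_update_epoch[OF h, where C = "capacity I" and A = A]
    have s: "arr_s ?B k = null_stock I k"
      using A upd(3)[of k] k by (simp add: null_before_def)
    have "arr_s ?B h = null_stock I h"
      using upd(1) assms A s unfolding consistent_at_def upd(2)
      by (simp add: k Let_def clamp_losses null_stock_Suc valid_instance_def del: stock.simps)
    then show ?thesis
      using A upd by (auto simp: null_before_def less_Suc_eq consistent_at_update_other)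
  qed
  then have "arr_d (result (null_arrays I)) = flow I \<and>
      null_before I (result (null_arrays I)) (Suc (epochs I))"
    unfolding null_arrays_def
    by (intro for_loop_invariant[where P = "\<lambda>h A. arr_d A = flow I \<and> null_before I A h"])
      (auto simp: null_before_def)
  then show ?thesis by simp
qed

section \<open>The forward scan as a composition of clamps\<close>

text \<open>Since \<open>p - d - s = (p - s') - lp + lm\<close> and
  \<open>[-\<alpha>, C - \<beta>]\<close> lies in \<open>[-s, C - s]\<close>, the inner clamp is
  absorbed. A loss puts \<open>s'\<close> on a boundary and thus fixes the sign of
  \<open>p - s'\<close>, so the part of the loss that fits into the interval can be pulled out.
  Bounding by \<open>s'\<close> is harmless because \<open>p\<close> lies in
  \<open>[0, C]\<close>.\<close>

lemma scan_step:
  assumes "0 \<le> \<alpha>" "\<alpha> \<le> s" "s \<le> \<beta>" "\<beta> \<le> C" "0 \<le> p" "p \<le> C"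
    and "r = s + d" "lp = surplus_of C r" "lm = stockout_of r" "s' = r - lp + lm"
    and "\<delta>p = min lp \<alpha>" "\<delta>m = min lm (C - \<beta>)"
    and "\<alpha>' = min (\<alpha> - \<delta>p) s'" "\<beta>' = max (\<beta> + \<delta>m) s'"
  shows "0 \<le> \<alpha>' \<and> \<alpha>' \<le> s' \<and> s' \<le> \<beta>' \<and> \<beta>' \<le> C \<and>
    clamp (- \<alpha>) (C - \<beta>) (clamp 0 C (p - d) - s) =
      - \<delta>p + \<delta>m + clamp (- \<alpha>') (C - \<beta>') (p - s')"
  using assms unfolding clamp_def surplus_of_def stockout_of_def by (smt (verit))

text \<open>
  During the scan, \<open>- \<alpha>\<close> and \<open>C - \<beta>\<close> bound the changes of the first stock whose effect is still
  present at the current epoch.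
\<close>

lemma scan_result:
  assumes "eu \<le> eo" "0 \<le> arr_s A eu" "arr_s A eu \<le> C"
    and cons: "\<And>h. eu < h \<Longrightarrow> h \<le> eo \<Longrightarrow> consistent_at C A h"
    and p: "\<And>h. eu \<le> h \<Longrightarrow> h < eo \<Longrightarrow> p h = clamp 0 C (p (Suc h) - arr_d A (Suc h))"
    and fin: "p eo = arr_s A eo" "0 \<le> p eo" "p eo \<le> C"
  shows "fst (result (for_loop (vi_body C A) (Suc eu) eo (x0, 0, arr_s A eu, arr_s A eu)))
    = x0 + p eu - arr_s A eu"
proof -
  \<comment> \<open>The accumulated correction plus the part still pending stays constant. Iteration
    \<open>h\<close> starts from the stock at \<open>h - 1\<close>.\<close>
  define P where "P = (\<lambda>h (x, L::int, \<alpha>, \<beta>). 0 \<le> \<alpha> \<and> \<alpha> \<le> arr_s A (h - 1) \<and>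
    arr_s A (h - 1) \<le> \<beta> \<and> \<beta> \<le> C \<and>
    x + clamp (- \<alpha>) (C - \<beta>) (p (h - 1) - arr_s A (h - 1)) = x0 + p eu - arr_s A eu)"
  have p_bounds: "0 \<le> p h \<and> p h \<le> C" if "eu \<le> h" "h \<le> eo" for h
    using that p[of h] fin clamp_bounds[of 0 C] assms(2,3) by (cases "h = eo") auto
  have "P (Suc eo) (result (for_loop (vi_body C A) (Suc eu) eo (x0, 0, arr_s A eu, arr_s A eu)))"
  proof (rule for_loop_invariant)
    show "P (Suc eu) (x0, 0, arr_s A eu, arr_s A eu)"
      using assms(2,3) p_bounds[of eu] assms(1) by (simp add: P_def clamp_def)
    show "Suc eu \<le> Suc eo" using assms(1) by simp
  next
    fix h b assume h: "Suc eu \<le> h" "h \<le> eo" and "P h b"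
    obtain x L \<alpha> \<beta> where b: "b = (x, L, \<alpha>, \<beta>)" by (cases b)
    obtain k where k: "h = Suc k" using h by (cases h) auto
    have cons': "consistent_at C A (Suc k)" using cons[of h] h k by simp
    have inv: "0 \<le> \<alpha>" "\<alpha> \<le> arr_s A k" "arr_s A k \<le> \<beta>" "\<beta> \<le> C"
      "x + clamp (- \<alpha>) (C - \<beta>) (p k - arr_s A k) = x0 + p eu - arr_s A eu"
      using \<open>P h b\<close> by (auto simp: P_def b k)
    have ph: "0 \<le> p h" "p h \<le> C" using p_bounds[of h] h by auto
    have pk: "p k = clamp 0 C (p h - arr_d A h)" using p[of k] h k by simp
    note scan = scan_step[OF inv(1-4) ph refl refl refl refl refl refl refl refl,
        of "arr_d A h", folded pk]
    show "P (Suc h) (result (vi_body C A h b))"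
      using scan inv(5) cons' unfolding consistent_at_def b
      by (simp add: P_def vi_body_def k Let_def)
  qed
  \<comment> \<open>As \<open>p eo = arr_s A eo\<close>, the pending part is a clamp of 0 to an
    interval containing 0.\<close>
  then show ?thesis
    using fin by (auto simp: P_def clamp_def split: prod.splits)
qed

lemma result_vehicle_intervention:
  assumes "0 \<le> Q"
    and "fst (result (for_loop (vi_body C A) (Suc eu) eo
      (- arr_sur A eu + arr_out A eu, 0, arr_s A eu, arr_s A eu))) = x"
  shows "\<exists>L LQ. result (vehicle_intervention C A eu eo q Q) = (clamp (q - Q) q x, LQ, x, L)"
  using assms by (auto simp: vehicle_intervention_def clamp_def Let_def split: prod.splits)

section \<open>Fictitious flows and the segments between visits\<close>

lemma result_fictitious_flow:
  "result (fictitious_flow C A eo \<delta>) =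
    (if 0 < \<delta> then - arr_s A (eo - 1) - \<bar>\<delta>\<bar>
     else if \<delta> < 0 then C - arr_s A (eo - 1) + \<bar>\<delta>\<bar> else 0)"
  by (simp add: fictitious_flow_def)

text \<open>For \<open>\<delta> > 0\<close> the fictitious stock is 0 and
  \<open>- f = s + \<delta>\<close>; for \<open>\<delta> < 0\<close> it is \<open>C\<close> and
  \<open>C - f = s + \<delta>\<close>. So going back over this epoch shifts the target by the
  residual.\<close>

lemma fictitious_clamp:
  assumes "0 \<le> s" "s \<le> C"
    and "f = (if 0 < \<delta> then - s - \<bar>\<delta>\<bar> else if \<delta> < 0 then C - s + \<bar>\<delta>\<bar> else 0)"
  shows "clamp 0 C (clamp 0 C (s + f) - f) = clamp 0 C (s + \<delta>)"
  using assms by (auto simp: clamp_def)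

text \<open>The conditional upper bound on \<open>h\<close> covers the stretch after the last visit
  as well as inner segments.\<close>

lemma no_visit_between:
  assumes "valid_instance I" "1 \<le> i"
    and "i < visits I \<Longrightarrow> h < visit I (Suc i)"
    and "i \<le> visits I" "visit I i < h"
  shows "h \<notin> visit I ` {1..visits I}"
proof
  assume "h \<in> visit I ` {1..visits I}"
  then obtain k where k: "k \<in> {1..visits I}" "h = visit I k" by auto
  have mono: "strict_mono_on {1..visits I} (visit I)"
    using assms(1) by (simp add: valid_instance_def)
  have "i < k"
    using k assms strict_mono_on_less[OF mono, of i k] by auto
  then show False
    using k assms strict_mono_on_less[OF mono, of k "Suc i"] by auto
qed

text \<open>One statement serves the first call and the recursive calls. The conditional hypotheses
  separate a proper segment from the degenerate one with the last visit at the final epoch, where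
  the scan is empty.\<close>

lemma segment_intervention:
  assumes valid: "valid_instance I" and i: "i \<in> {1..visits I}"
    and null: "null_before I A eo" and eo: "visit I i \<le> eo" "eo \<le> epochs I"
    and no_visit: "\<And>h. visit I i < h \<Longrightarrow> h < eo \<Longrightarrow> h \<notin> visit I ` {1..visits I}"
    and at_start: "visit I i = eo \<Longrightarrow> null_before I A (Suc eo)"
    and cons: "consistent_at (capacity I) A eo"
    and before: "visit I i < eo \<Longrightarrow>
      target I (eo - 1) = clamp 0 (capacity I) (arr_s A eo - arr_d A eo)"
    and final: "visit I i = eo \<Longrightarrow> target I eo = arr_s A eo"
    and s_eo: "0 \<le> arr_s A eo" "arr_s A eo \<le> capacity I"
  shows "\<exists>L LQ. result (vehicle_intervention (capacity I) A (visit I i) eo (load I i) (vcap I i))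
    = (policy I (visit I i), LQ,
       target I (visit I i) - (null_stock I (visit I i - 1) + flow I (visit I i)), L)"
proof -
  let ?C = "capacity I" and ?e = "visit I i"
  have vcap: "0 \<le> vcap I i"
    using valid i unfolding valid_instance_def by fastforce
  have "1 \<le> ?e"
    using valid i strict_mono_on_less_eq[of "{1..visits I}" "visit I" 1 i]
    by (auto simp: valid_instance_def)
  have null_e: "arr_s A ?e = null_stock I ?e" "arr_d A ?e = flow I ?e" "consistent_at ?C A ?e"
    "arr_s A (?e - 1) = null_stock I (?e - 1)"
    using null at_start eo(1) \<open>1 \<le> ?e\<close> by (cases "?e = eo"; simp add: null_before_def)+
  \<comment> \<open>At \<open>eo\<close> the array stock replaces the target, so that the scan ends
    with nothing pending even after a fictitious flow.\<close>
  define p where "p h = (if h = eo then arr_s A eo else target I h)" for h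
  have "fst (result (for_loop (vi_body ?C A) (Suc ?e) eo
      (- arr_sur A ?e + arr_out A ?e, 0, arr_s A ?e, arr_s A ?e)))
    = (- arr_sur A ?e + arr_out A ?e) + p ?e - arr_s A ?e"
  proof (rule scan_result)
    show "consistent_at ?C A h" if "?e < h" "h \<le> eo" for h
      using that cons null by (cases "h = eo") (auto simp: null_before_def)
    show "p h = clamp 0 ?C (p (Suc h) - arr_d A (Suc h))" if h: "?e \<le> h" "h < eo" for h
    proof (cases "Suc h = eo")
      case True
      then show ?thesis using before h by (auto simp: p_def)
    next
      case False
      then have "policy I (Suc h) = 0" "arr_d A (Suc h) = flow I (Suc h)"
        using no_visit[of "Suc h"] h null by (auto simp: policy_no_visit null_before_def)
      then show ?thesis
        using False h eo target_back[of h I] by (simp add: p_def)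
    qed
  qed (use eo s_eo null_e stock_bounds[OF valid] in \<open>auto simp: p_def\<close>)
  also have "p ?e = target I ?e"
    using final by (simp add: p_def)
  \<comment> \<open>By consistency at the visit, the initial losses cancel against those contained
    in the stock.\<close>
  also have "(- arr_sur A ?e + arr_out A ?e) + target I ?e - arr_s A ?e
      = target I ?e - (null_stock I (?e - 1) + flow I ?e)"
    using null_e by (simp add: consistent_at_def Let_def)
  finally show ?thesis
    by (subst policy_visit[OF valid i], intro result_vehicle_intervention)
      (auto simp: vcap)
qed

text \<open>Both hypotheses pass to the recursive call: the overwritten epoch lies after the next
  segment's visit, and the scan returns the unclamped correction that determines the next
  residual.\<close>

lemma result_backward_rec:
  assumes valid: "valid_instance I" and "j < visits I"
    and "null_before I A (visit I (Suc j))"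
    and "\<delta> = target I (visit I (Suc j))
      - (null_stock I (visit I (Suc j) - 1) + flow I (visit I (Suc j)))
      - policy I (visit I (Suc j))"
  shows "length (fst (result (backward_rec I j A \<delta>))) = j \<and>
    (\<forall>i\<in>{1..j}. fst (result (backward_rec I j A \<delta>)) ! (i - 1) = policy I (visit I i))"
  using assms(2-)
proof (induction j arbitrary: A \<delta>)
  case 0
  then show ?case by simp
next
  case (Suc j)
  let ?C = "capacity I" and ?eu = "visit I (Suc j)" and ?eo = "visit I (Suc (Suc j))"
  define f where "f = result (fictitious_flow ?C A ?eo \<delta>)"
  define B where "B = A\<lparr>arr_d := (arr_d A)(?eo := f)\<rparr>"
  define A' where "A' = result (update_epoch ?C ?eo B)"
  have mono: "strict_mono_on {1..visits I} (visit I)" and C: "0 \<le> ?C"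
    using valid by (auto simp: valid_instance_def)
  have lt: "?eu < ?eo"
    using strict_mono_on_less[OF mono, of "Suc j" "Suc (Suc j)"] Suc.prems(1) by auto
  have eo_m: "?eo \<le> epochs I"
    using strict_mono_on_less_eq[OF mono, of "Suc (Suc j)" "visits I"] Suc.prems(1) valid
    by (auto simp: valid_instance_def)
  obtain k where k: "?eo = Suc k" using lt by (cases ?eo) auto
  have upd: "consistent_at ?C A' ?eo" "arr_d A' = (arr_d A)(?eo := f)"
    "\<And>h. h \<noteq> ?eo \<Longrightarrow> arr_s A' h = arr_s A h"
    using result_update_epoch[where h = ?eo and C = ?C and A = B] lt by (auto simp: A'_def B_def)
  have "consistent_at ?C A' h" if "1 \<le> h" "h < ?eo" for h
  proof -
    have "consistent_at ?C A h" using that Suc.prems(2) by (simp add: null_before_def)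
    then have "consistent_at ?C B h" using that by (simp add: B_def consistent_at_def)
    then show ?thesis using that by (simp add: A'_def consistent_at_update_other)
  qed
  then have null: "null_before I A' ?eo"
    using Suc.prems(2) upd by (auto simp: null_before_def)
  have sk: "arr_s A' k = null_stock I k" "arr_s A k = null_stock I k"
    using null Suc.prems(2) by (auto simp: null_before_def k)
  have s_eo: "arr_s A' ?eo = clamp 0 ?C (null_stock I k + f)"
    using upd(1,2) sk clamp_losses[OF C] by (simp add: consistent_at_def k Let_def)
  have "clamp 0 ?C (arr_s A' ?eo - f) = clamp 0 ?C (null_stock I k + \<delta>)"
    unfolding s_eo using stock_bounds[OF valid] sk
    by (intro fictitious_clamp) (auto simp: f_def result_fictitious_flow k)
  \<comment> \<open>The residual moves the null stock to the unclamped predecessor of the target at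
    \<open>?eo\<close>.\<close>
  also have "null_stock I k + \<delta> = target I ?eo - flow I ?eo - policy I ?eo"
    using Suc.prems(3) by (simp add: k)
  also have "clamp 0 ?C \<dots> = target I k"
    using target_back[of k I] eo_m by (simp add: k)
  finally have tk: "target I k = clamp 0 ?C (arr_s A' ?eo - arr_d A' ?eo)"
    by (simp add: upd)
  define x where "x = target I ?eu - (null_stock I (?eu - 1) + flow I ?eu)"
  obtain L LQ where vi: "result (vehicle_intervention ?C A' ?eu ?eo (load I (Suc j))
      (vcap I (Suc j))) = (policy I ?eu, LQ, x, L)"
    using segment_intervention[OF valid, of "Suc j" A' ?eo] Suc.prems(1) null lt eo_m upd(1) tk k
      no_visit_between[OF valid, of "Suc j"] clamp_bounds[OF C] s_eo
    unfolding x_def by fastforce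
  have IH: "length (fst (result (backward_rec I j A' (x - policy I ?eu)))) = j"
    "\<forall>i\<in>{1..j}. fst (result (backward_rec I j A' (x - policy I ?eu))) ! (i - 1)
      = policy I (visit I i)"
    using Suc.IH[of A' "x - policy I ?eu"] Suc.prems(1) null lt
    by (auto simp: x_def null_before_def)
  have "fst (result (backward_rec I (Suc j) A \<delta>))
      = fst (result (backward_rec I j A' (x - policy I ?eu))) @ [policy I ?eu]"
    by (simp add: f_def[symmetric] B_def[symmetric] A'_def[symmetric] vi Let_def split: prod.splits)
  then show ?case
    using IH by (auto simp: nth_append le_Suc_eq)
qed

text \<open>The last segment ends where target and null stock agree, so its scan can use the
  unmodified arrays.\<close>

lemma result_global_backward:
  assumes valid: "valid_instance I"
  defines "xs \<equiv> fst (result (global_backward I))"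
  shows "length xs = visits I \<and> (\<forall>i\<in>{1..visits I}. xs ! (i - 1) = policy I (visit I i))"
proof -
  let ?C = "capacity I" and ?w = "visits I" and ?m = "epochs I"
  define A where "A = result (null_arrays I)"
  have null: "null_before I A (Suc ?m)"
    using null_arrays_null[OF valid] by (simp add: A_def)
  have w: "?w \<in> {1..visits I}" "visit I ?w \<le> ?m" and m: "1 \<le> ?m"
    using valid by (auto simp: valid_instance_def)
  have at_m: "arr_s A ?m = null_stock I ?m" "arr_d A ?m = flow I ?m" "consistent_at ?C A ?m"
    using null m by (auto simp: null_before_def)
  define x where "x = target I (visit I ?w) - (null_stock I (visit I ?w - 1) + flow I (visit I ?w))"
  have "\<exists>L LQ. result (vehicle_intervention ?C A (visit I ?w) ?m (load I ?w) (vcap I ?w))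
    = (policy I (visit I ?w), LQ, x, L)"
    unfolding x_def
  proof (rule segment_intervention[OF valid w(1)])
    show no: "h \<notin> visit I ` {1..visits I}" if "visit I ?w < h" for h
      by (rule no_visit_between[OF valid _ _ _ that]) (use w in auto)
    show "target I (?m - 1) = clamp 0 ?C (arr_s A ?m - arr_d A ?m)" if "visit I ?w < ?m"
      using target_back[of "?m - 1" I] m no[OF that] at_m
      by (simp add: target_final policy_no_visit del: stock.simps)
  qed (use null w at_m stock_bounds[OF valid] in \<open>auto simp: null_before_def target_final\<close>)
  then obtain L LQ where vi: "result (vehicle_intervention ?C A (visit I ?w) ?m (load I ?w)
      (vcap I ?w)) = (policy I (visit I ?w), LQ, x, L)"
    by auto
  let ?ys = "fst (result (backward_rec I (?w - 1) A (x - policy I (visit I ?w))))"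
  have rec: "length ?ys = ?w - 1 \<and> (\<forall>i\<in>{1..?w - 1}. ?ys ! (i - 1) = policy I (visit I i))"
    by (rule result_backward_rec[OF valid])
      (use w null in \<open>auto simp: null_before_def x_def\<close>)
  have "xs = ?ys @ [policy I (visit I ?w)]"
    by (simp add: xs_def global_backward_def A_def[symmetric] vi Let_def split: prod.splits)
  moreover obtain j where "?w = Suc j" using w(1) by (cases ?w) auto
  ultimately show ?thesis
    using rec by (auto simp: nth_append le_Suc_eq)
qed

section \<open>Operation counts\<close>

text \<open>A scan iteration costs 13 operations and 2 for loop control; 10 covers the rest.\<close>

lemma ops_vehicle_intervention:
  "ops (vehicle_intervention C A eu eo q Q) \<le> 10 + 15 * (eo - eu)"
proof -
  have "ops (for_loop (vi_body C A) (Suc eu) eo a) \<le> 1 + (13 + 2) * (Suc eo - Suc eu)" for a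
    by (rule for_loop_ops) (simp add: vi_body_def split: prod.splits)
  from this[of "(- arr_sur A eu + arr_out A eu, 0, arr_s A eu, arr_s A eu)"]
  show ?thesis
    by (simp add: vehicle_intervention_def Let_def split: prod.splits)
qed

text \<open>The scan lengths telescope into the visit epoch, which keeps the total linear; 30 covers
  the other work per visit.\<close>

lemma ops_backward_rec:
  assumes "valid_instance I" "j < visits I"
  shows "ops (backward_rec I j A \<delta>) \<le> 2 + 30 * j + 15 * visit I (Suc j)"
  using assms(2)
proof (induction j arbitrary: A \<delta>)
  case 0
  then show ?case by simp
next
  case (Suc j)
  have "strict_mono_on {1..visits I} (visit I)"
    using assms(1) by (simp add: valid_instance_def)
  then have lt: "visit I (Suc j) < visit I (Suc (Suc j))"
    using strict_mono_on_less[of "{1..visits I}" "visit I" "Suc j" "Suc (Suc j)"] Suc.prems by auto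
  let ?A = "result (update_epoch (capacity I) (visit I (Suc (Suc j)))
    (A\<lparr>arr_d := (arr_d A)(visit I (Suc (Suc j)) :=
      result (fictitious_flow (capacity I) A (visit I (Suc (Suc j))) \<delta>))\<rparr>))"
  have upd: "ops (update_epoch C h B) = 8" for C h B
    by (simp add: update_epoch_def)
  have fic: "ops (fictitious_flow C B h \<delta>) \<le> 6" for C B h
    by (simp add: fictitious_flow_def)
  have rec: "ops (backward_rec I j B \<epsilon>) \<le> 2 + 30 * j + 15 * visit I (Suc j)" for B \<epsilon>
    using Suc by simp
  obtain xQ LQ x L where vi: "result (vehicle_intervention (capacity I) ?A (visit I (Suc j))
      (visit I (Suc (Suc j))) (load I (Suc j)) (vcap I (Suc j))) = (xQ, LQ, x, L)"
    by (metis prod_cases4)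
  show ?case
    using ops_vehicle_intervention[of "capacity I" ?A "visit I (Suc j)" "visit I (Suc (Suc j))"
        "load I (Suc j)" "vcap I (Suc j)"]
      fic[of "capacity I" A "visit I (Suc (Suc j))"] rec[of ?A "x - xQ"] lt
    by (simp add: upd vi Let_def split: prod.splits)
qed

text \<open>Absorbs the constant cost per visit into the bound linear in
  \<open>epochs I\<close>.\<close>

lemma visits_le_epochs:
  assumes "valid_instance I"
  shows "visits I \<le> epochs I"
proof -
  have mono: "strict_mono_on {1..visits I} (visit I)"
    and e: "visit I 1 = 1" "visit I (visits I) \<le> epochs I"
    using assms by (auto simp: valid_instance_def)
  have "visit I ` {1..visits I} \<subseteq> {1..epochs I}"
    using strict_mono_on_less_eq[OF mono, of 1] strict_mono_on_less_eq[OF mono, of _ "visits I"] e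
    by fastforce
  then have "card {1..visits I} \<le> card {1..epochs I}"
    using visit_inj[OF assms] by (meson card_inj_on_le finite_atLeastAtMost)
  then show ?thesis by simp
qed

lemma ops_global_backward:
  assumes "valid_instance I"
  shows "ops (global_backward I) \<le> 90 * epochs I"
proof -
  let ?w = "visits I" and ?m = "epochs I" and ?A = "result (null_arrays I)"
  have w: "1 \<le> ?w" "visit I ?w \<le> ?m" "1 \<le> ?m" "?w \<le> ?m"
    using assms visits_le_epochs by (auto simp: valid_instance_def)
  have "ops (null_arrays I) \<le> 1 + (8 + 2) * (Suc ?m - 1)"
    unfolding null_arrays_def by (rule for_loop_ops) (simp add: update_epoch_def)
  moreover obtain xQ LQ x L where vi: "result (vehicle_intervention (capacity I) ?A (visit I ?w) ?m
      (load I ?w) (vcap I ?w)) = (xQ, LQ, x, L)"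
    by (metis prod_cases4)
  moreover have "ops (backward_rec I (?w - 1) ?A (x - xQ)) \<le> 2 + 30 * (?w - 1) + 15 * visit I ?w"
    using ops_backward_rec[OF assms, of "?w - 1"] w by simp
  ultimately show ?thesis
    using ops_vehicle_intervention[of "capacity I" ?A "visit I ?w" ?m "load I ?w" "vcap I ?w"] w
    by (simp add: global_backward_def Let_def split: prod.splits)
qed

theorem theorem3:
  shows "\<exists>c::nat. \<forall>I. valid_instance I \<longrightarrow>
    (let xs = fst (result (global_backward I)) in
       ops (global_backward I) \<le> c * epochs I \<and>
       optimal I xs \<and>
       stock I xs (epochs I) = stock I (null_vector I) (epochs I))"
  using ops_global_backward policy_optimal result_global_backward
  unfolding Let_def by blast

end
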